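(* There is a universal constant $c>0$ such that for all integers $1\le d\le m$ there are a domain $\mathcal X$, a class $\mathcal H$ of functions $\mathcal X\to[0,1]$ with $|\mathcal H|=2^d$, and a family of distributions $\mathcal D$ on $\mathcal X\times\{0,1\}$ such that every possibly randomized learner that, from $m$ i.i.d. samples from $\mathcal D$, outputs a randomized predictor $\hat p$ satisfies $$\sup_{\mathcal D}\ \mathbb E\,\mathrm{SwapAgn}_{\mathcal D}(\ell_\vee,\mathcal H)\ \ge\ c\sqrt{\frac dm}\ =\ \Omega\!\left(\sqrt{\frac{\log|\mathcal H|}{m}}\right),$$ where the supremum is over the family, the expectation is over the sample and the learner's randomness, and $$\ell_\vee(p,y)=\begin{cases}y-\frac12,&p\le\frac12,\\[2pt]\frac12-y,&p>\frac12.\end{cases}$$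
   Context: $\Gamma_N=\{0,1/N,\dots,1\}$, for an arbitrary grid size $N$ chosen by the learner. A randomized predictor $\hat p$ maps each $x\in\mathcal X$ to a distribution on $\Gamma_N$. Its swap-agnostic excess risk for a loss $\ell$ is $$\mathrm{SwapAgn}_{\mathcal D}(\ell,\mathcal H)=\sup_{\phi:\Gamma_N\to\mathcal H}\mathbb E_{(X,Y)\sim\mathcal D,\ p\sim\hat p(X)}\big[\ell(p,Y)-\ell(\phi(p)(X),Y)\big].$$ *)

theory Defs
  imports "HOL-Probability.Probability"
begin

definition grid :: "nat \<Rightarrow> real set" where
  "grid N = (\<lambda>k. real k / real N) ` {..N}"

definition loss_or :: "real \<Rightarrow> real \<Rightarrow> real" where
  "loss_or p y = (if p \<le> 1/2 then y - 1/2 else 1/2 - y)"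

text \<open>
  For bounded losses and nonempty \<open>H\<close> the supremum below ranges over a bounded nonempty set, so
  \<open>SUP\<close> on the reals is the true supremum.
\<close>

definition swap_agn ::
  "(real \<Rightarrow> real \<Rightarrow> real) \<Rightarrow> ('a \<Rightarrow> real) set \<Rightarrow> ('a \<times> real) pmf \<Rightarrow> nat \<Rightarrow> ('a \<Rightarrow> real pmf) \<Rightarrow> real" where
  "swap_agn l H D N q =
     (SUP \<phi>\<in>grid N \<rightarrow>\<^sub>E H.
        measure_pmf.expectation
          (do {(x, y) \<leftarrow> D; p \<leftarrow> q x; return_pmf (x, y, p)})
          (\<lambda>(x, y, p). l p y - l (\<phi> p x) y))"

text \<open>
  An output of a learner is a pair of a grid size and a randomized predictor with values on that
  grid. The sigma-algebra is the coarsest one for which the grid size and all the probabilities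
  \<open>pmf (q x) v\<close> are measurable.
\<close>

definition predictors :: "'a set \<Rightarrow> (nat \<times> ('a \<Rightarrow> real pmf)) set" where
  "predictors X = {(N, q). 1 \<le> N \<and> q \<in> X \<rightarrow>\<^sub>E {r. set_pmf r \<subseteq> grid N}}"

definition predictor_space :: "'a set \<Rightarrow> (nat \<times> ('a \<Rightarrow> real pmf)) measure" where
  "predictor_space X = sigma (predictors X)
     ({{(N, q) \<in> predictors X. N = n} | n. True} \<union>
      {{(N, q) \<in> predictors X. pmf (q x) v \<le> a} | x v a. x \<in> X})"

text \<open>
  A randomized learner is given by the law of its output conditional on the sample; as the kernel
  is arbitrary, this covers every source of internal randomness and a grid size that may depend on
  the sample and on that randomness.  Samples carry the discrete sigma-algebra, since all sample
  distributions are discrete.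
\<close>

definition randomized_learner ::
  "'a set \<Rightarrow> nat \<Rightarrow> (('a \<times> real) list \<Rightarrow> (nat \<times> ('a \<Rightarrow> real pmf)) measure) \<Rightarrow> bool" where
  "randomized_learner X m L \<longleftrightarrow>
     L \<in> count_space {s. length s = m \<and> set s \<subseteq> X \<times> {0, 1}} \<rightarrow>\<^sub>M prob_algebra (predictor_space X)"

definition expected_swap_agn ::
  "(real \<Rightarrow> real \<Rightarrow> real) \<Rightarrow> ('a \<Rightarrow> real) set \<Rightarrow> nat \<Rightarrow>
   (('a \<times> real) list \<Rightarrow> (nat \<times> ('a \<Rightarrow> real pmf)) measure) \<Rightarrow> ('a \<times> real) pmf \<Rightarrow> real" where
  "expected_swap_agn l H m L D =
     measure_pmf.expectation (replicate_pmf m D)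
       (\<lambda>s. \<integral>(N, q). swap_agn l H D N q \<partial>L s)"

end

theory Submission
  imports Defs
begin

text \<open>
  The swap excess risk is at least the excess risk against a constant \<open>\<phi>\<close>, so an agnostic lower
  bound suffices. Take \<open>{..<d}\<close> as domain with all \<open>{0, 1}\<close>-valued functions as benchmark. For
  \<open>\<sigma> \<subseteq> {..<d}\<close> the covariate is uniform and the label at \<open>i\<close> is Bernoulli with mean
  \<open>1/2 + e\<close> if \<open>i \<in> \<sigma>\<close> and \<open>1/2 - e\<close> otherwise, where \<open>e = sqrt (d / m) / 4\<close>. Against the indicator
  of \<open>\<sigma>\<close> the excess is \<open>2 e\<close> times the average over \<open>i\<close> of the probability that the prediction at
  \<open>i\<close> lies on the wrong side of \<open>1/2\<close>. Averaging over \<open>\<sigma>\<close> and pairing \<open>\<sigma>\<close> with its flip at \<open>i\<close>, each such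
  term is a two-point testing problem whose Bhattacharyya affinity is at least
  \<open>(1 - 4 e\<^sup>2 / d) ^ m \<ge> 3/4\<close>, which keeps the error bounded away from 0.
\<close>

section \<open>Product laws on samples, Bhattacharyya affinity and two-point testing\<close>

lemma pmf_replicate_pmf_Cons:
  "pmf (replicate_pmf (Suc n) p) (x # xs) = pmf p x * pmf (replicate_pmf n p) xs"
proof -
  have eq: "replicate_pmf (Suc n) p = map_pmf (\<lambda>(x, xs). x # xs) (pair_pmf p (replicate_pmf n p))"
    by (simp add: pair_pmf_def map_bind_pmf map_return_pmf)
  have "inj (\<lambda>(x, xs). x # xs)"
    by (auto simp: inj_def)
  from pmf_map_inj'[OF this, of "pair_pmf p (replicate_pmf n p)" "(x, xs)"] show ?thesis
    unfolding eq by (simp add: pmf_pair del: replicate_pmf.simps)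
qed

text \<open>Point masses of a product law multiply over coordinates, and so do their square roots,
  so the sum over lists factorizes: Bhattacharyya affinity tensorizes.\<close>

lemma sum_sqrt_pmf_replicate:
  assumes "finite A"
  shows "(\<Sum>s | set s \<subseteq> A \<and> length s = n. sqrt (pmf (replicate_pmf n p) s * pmf (replicate_pmf n q) s))
    = (\<Sum>x\<in>A. sqrt (pmf p x * pmf q x)) ^ n"
proof (induction n)
  case 0
  have "{s. set s \<subseteq> A \<and> length s = 0} = {[]}" by auto
  then show ?case by simp
next
  case (Suc n)
  let ?S = "\<lambda>n. {s. set s \<subseteq> A \<and> length s = n}"
  have inj: "inj_on (\<lambda>(xs, x). x # xs) (?S n \<times> A)" by (auto simp: inj_on_def)
  have "(\<Sum>s\<in>?S (Suc n). sqrt (pmf (replicate_pmf (Suc n) p) s * pmf (replicate_pmf (Suc n) q) s))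
    = (\<Sum>(xs, x)\<in>?S n \<times> A.
        sqrt (pmf (replicate_pmf n p) xs * pmf (replicate_pmf n q) xs) * sqrt (pmf p x * pmf q x))"
    unfolding lists_length_Suc_eq sum.reindex[OF inj]
    by (intro sum.cong)
      (auto simp: pmf_replicate_pmf_Cons real_sqrt_mult algebra_simps simp del: replicate_pmf.simps)
  also have "\<dots> = (\<Sum>xs\<in>?S n. sqrt (pmf (replicate_pmf n p) xs * pmf (replicate_pmf n q) xs))
      * (\<Sum>x\<in>A. sqrt (pmf p x * pmf q x))"
    by (simp add: sum_product sum.cartesian_product)
  finally show ?case using Suc by simp
qed

lemma expectation_replicate_pmf:
  fixes f :: "'a list \<Rightarrow> real"
  assumes "finite A" "set_pmf p \<subseteq> A"
  shows "measure_pmf.expectation (replicate_pmf n p) f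
    = (\<Sum>s | set s \<subseteq> A \<and> length s = n. pmf (replicate_pmf n p) s * f s)"
proof -
  have "measure_pmf.expectation (replicate_pmf n p) f
    = (\<Sum>s | set s \<subseteq> A \<and> length s = n. f s * pmf (replicate_pmf n p) s)"
    using assms
    by (intro integral_measure_pmf_real finite_lists_length_eq) (auto simp: set_replicate_pmf)
  then show ?thesis by (simp add: mult.commute)
qed

text \<open>The bound is linear in \<open>P\<close>, \<open>Q\<close> and \<open>sqrt (P * Q)\<close>, so it can be summed over the samples
  without the Cauchy-Schwarz inequality.\<close>

lemma mixture_ge_sqrt:
  fixes P Q t :: real
  assumes "P \<ge> 0" "Q \<ge> 0" "0 \<le> t" "t \<le> 1"
  shows "P * t + Q * (1 - t) \<ge> (4 * sqrt (P * Q) - P - Q) / 3"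
proof -
  \<comment> \<open>AM-GM for \<open>4 * a\<close> and \<open>b\<close>. The weight 4 leaves
    \<open>3 * a\<close> after subtracting \<open>a + b\<close>; using it both ways yields
    \<open>3 * min P Q\<close>.\<close>
  have *: "4 * sqrt (a * b) \<le> 4 * a + b" if "0 \<le> a" "0 \<le> b" for a b :: real
    using arith_geo_mean_sqrt[of "4 * a" b] that by (simp add: real_sqrt_mult)
  have "4 * sqrt (P * Q) - P - Q \<le> 3 * min P Q"
    using *[of P Q] *[of Q P] assms by (auto simp: min_def mult.commute)
  then have "(4 * sqrt (P * Q) - P - Q) / 3 \<le> min P Q" by (simp only: divide_le_eq) simp
  moreover have "min P Q * t \<le> P * t" "min P Q * (1 - t) \<le> Q * (1 - t)"
    using assms by (auto intro!: mult_right_mono)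
  moreover have "min P Q * t + min P Q * (1 - t) = min P Q"
    by (simp add: algebra_simps)
  ultimately show ?thesis by linarith
qed

text \<open>With \<open>a s\<close> the probability that a test decides for \<open>q\<close> on
  sample \<open>s\<close>, the left side is the sum of its two error probabilities.
  \<open>mixture_ge_sqrt\<close> is summed over all samples: the two total masses give the 2, the
  square roots give a power of the one-sample affinity.\<close>

lemma two_point_testing_bound:
  fixes a :: "'a list \<Rightarrow> real"
  assumes "finite A" "set_pmf p \<subseteq> A" "set_pmf q \<subseteq> A"
    and "\<And>s. set s \<subseteq> A \<Longrightarrow> length s = n \<Longrightarrow> 0 \<le> a s \<and> a s \<le> 1"
  shows "measure_pmf.expectation (replicate_pmf n p) a
    + measure_pmf.expectation (replicate_pmf n q) (\<lambda>s. 1 - a s)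
    \<ge> (4 * (\<Sum>x\<in>A. sqrt (pmf p x * pmf q x)) ^ n - 2) / 3"
proof -
  let ?S = "{s. set s \<subseteq> A \<and> length s = n}"
  let ?P = "pmf (replicate_pmf n p)" and ?Q = "pmf (replicate_pmf n q)"
  have fin: "finite ?S" using assms(1) by (rule finite_lists_length_eq)
  have "set_pmf (replicate_pmf n p) \<subseteq> ?S" "set_pmf (replicate_pmf n q) \<subseteq> ?S"
    using assms(2,3) by (auto simp: set_replicate_pmf)
  then have one: "sum ?P ?S = 1" "sum ?Q ?S = 1"
    using fin by (auto intro: sum_pmf_eq_1)
  have "(4 * (\<Sum>x\<in>A. sqrt (pmf p x * pmf q x)) ^ n - 2) / 3
    = (\<Sum>s\<in>?S. (4 * sqrt (?P s * ?Q s) - ?P s - ?Q s) / 3)"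
    unfolding sum_divide_distrib[symmetric] sum_subtractf one sum_distrib_left[symmetric]
      sum_sqrt_pmf_replicate[OF assms(1)] by simp
  also have "\<dots> \<le> (\<Sum>s\<in>?S. ?P s * a s + ?Q s * (1 - a s))"
    using assms(4) by (intro sum_mono mixture_ge_sqrt) auto
  finally show ?thesis
    using assms by (simp add: expectation_replicate_pmf[OF assms(1)] sum.distrib)
qed

section \<open>Measurability on the space of predictors\<close>

lemma finite_grid [simp]: "finite (grid N)"
  by (simp add: grid_def)

lemma space_predictor_space [simp]: "space (predictor_space X) = predictors X"
  unfolding predictor_space_def by (rule space_measure_of) auto

lemma sets_predictor_space:
  "sets (predictor_space X) = sigma_sets (predictors X)
     ({{(N, q) \<in> predictors X. N = n} | n. True} \<union>
      {{(N, q) \<in> predictors X. pmf (q x) v \<le> a} | x v a. x \<in> X})"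
  unfolding predictor_space_def by (rule sets_measure_of) auto

lemma measurable_grid_size [measurable]:
  "fst \<in> predictor_space X \<rightarrow>\<^sub>M count_space UNIV"
  unfolding measurable_count_space_eq2_countable
proof (intro conjI ballI)
  fix n :: nat
  have "fst -` {n} \<inter> space (predictor_space X) = {(N, q) \<in> predictors X. N = n}"
    by auto
  then show "fst -` {n} \<inter> space (predictor_space X) \<in> sets (predictor_space X)"
    unfolding sets_predictor_space by (auto intro!: sigma_sets.Basic)
qed auto

lemma measurable_pmf_predictor [measurable]:
  assumes "x \<in> X"
  shows "(\<lambda>w. pmf (snd w x) v) \<in> borel_measurable (predictor_space X)"
  unfolding borel_measurable_iff_le
proof
  fix a
  have "{w \<in> space (predictor_space X). pmf (snd w x) v \<le> a}
    = {(N, q) \<in> predictors X. pmf (q x) v \<le> a}"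
    by auto
  moreover have "\<dots> \<in> sets (predictor_space X)"
    unfolding sets_predictor_space using assms by (intro sigma_sets.Basic UnI2) blast
  ultimately show "{w \<in> space (predictor_space X). pmf (snd w x) v \<le> a} \<in> sets (predictor_space X)"
    by simp
qed

lemma prob_predictor_eq_sum:
  assumes "(N, q) \<in> predictors X" "x \<in> X"
  shows "measure_pmf.prob (q x) B = (\<Sum>v\<in>grid N \<inter> B. pmf (q x) v)"
proof -
  have "set_pmf (q x) \<subseteq> grid N" using assms by (auto simp: predictors_def PiE_iff)
  then have "measure_pmf.prob (q x) B = measure_pmf.prob (q x) (grid N \<inter> B)"
    by (intro measure_pmf.finite_measure_eq_AE) (auto simp: AE_measure_pmf_iff)
  then show ?thesis by (simp add: measure_measure_pmf_finite)
qed

text \<open>The sigma-algebra is generated by the grid size and point masses. On each of the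
  countably many level sets of the grid size, the probability is a fixed finite sum of point
  masses.\<close>

lemma measurable_prob_predictor:
  assumes "x \<in> X"
  shows "(\<lambda>w. measure_pmf.prob (snd w x) B) \<in> borel_measurable (predictor_space X)"
proof -
  have "(\<lambda>w. \<Sum>v\<in>grid n \<inter> B. pmf (snd w x) v) \<in> borel_measurable (predictor_space X)" for n
    using assms by measurable
  from measurable_compose_countable[OF this measurable_grid_size]
  have "(\<lambda>w. \<Sum>v\<in>grid (fst w) \<inter> B. pmf (snd w x) v) \<in> borel_measurable (predictor_space X)" .
  then show ?thesis
    by (rule measurable_cong[THEN iffD2, rotated]) (use assms in \<open>auto intro: prob_predictor_eq_sum\<close>)
qed

section \<open>Swap excess risk under a finitely supported distribution\<close>

text \<open>The objective of \<open>swap_agn\<close> for one \<open>\<phi>\<close>, when the finite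
  set \<open>A\<close> carries \<open>D\<close> and \<open>q\<close> takes values on the
  grid.\<close>

definition swap_excess ::
  "(real \<Rightarrow> real \<Rightarrow> real) \<Rightarrow> ('a \<times> real) set \<Rightarrow> ('a \<times> real) pmf \<Rightarrow> nat \<Rightarrow> ('a \<Rightarrow> real pmf) \<Rightarrow>
   (real \<Rightarrow> 'a \<Rightarrow> real) \<Rightarrow> real" where
  "swap_excess l A D N q \<phi> = (\<Sum>z\<in>A. pmf D z *
     (\<Sum>v\<in>grid N. pmf (q (fst z)) v * (l v (snd z) - l (\<phi> v (fst z)) (snd z))))"

lemma swap_agn_eq:
  assumes "finite A" "set_pmf D \<subseteq> A" "fst ` A \<subseteq> X" "(N, q) \<in> predictors X"
  shows "swap_agn l H D N q = (SUP \<phi>\<in>grid N \<rightarrow>\<^sub>E H. swap_excess l A D N q \<phi>)"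
proof -
  have q: "set_pmf (q (fst z)) \<subseteq> grid N" if "z \<in> A" for z
    using assms that by (auto simp: predictors_def PiE_iff)
  have fin: "finite (set_pmf (q (fst z)))" if "z \<in> A" for z
    using finite_subset[OF q[OF that]] by simp
  have "measure_pmf.expectation (do {(x, y) \<leftarrow> D; p \<leftarrow> q x; return_pmf (x, y, p)})
          (\<lambda>(x, y, p). l p y - l (\<phi> p x) y) = swap_excess l A D N q \<phi>" for \<phi>
    unfolding swap_excess_def using assms(1,2) fin q
    by (subst pmf_expectation_bind[of A])
      (auto simp: case_prod_beta pmf_expectation_bind[of "grid N"] intro!: sum.cong)
  then show ?thesis unfolding swap_agn_def by simp
qed

text \<open>A constant \<open>\<phi>\<close> turns swap risk into agnostic excess risk. Finiteness
  of \<open>H\<close> makes the index set finite, so the supremum is a true upper bound.\<close>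

lemma swap_agn_ge:
  assumes "finite A" "set_pmf D \<subseteq> A" "fst ` A \<subseteq> X" "(N, q) \<in> predictors X"
    and "finite H" "h \<in> H"
  shows "swap_agn l H D N q \<ge> swap_excess l A D N q (\<lambda>_. h)"
proof -
  have fin: "finite (grid N \<rightarrow>\<^sub>E H)"
    using assms(5) by (intro finite_PiE) auto
  \<comment> \<open>The competitors are extensional, hence the restriction; the sum only evaluates
    them at grid points.\<close>
  have "swap_excess l A D N q (\<lambda>_. h) = swap_excess l A D N q (restrict (\<lambda>_. h) (grid N))"
    unfolding swap_excess_def by (intro sum.cong refl arg_cong2[where f = "(*)"]) auto
  also have "\<dots> \<le> (SUP \<phi>\<in>grid N \<rightarrow>\<^sub>E H. swap_excess l A D N q \<phi>)"
    using assms(6) fin by (intro cSUP_upper) auto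
  finally show ?thesis by (simp add: swap_agn_eq[OF assms(1-4)])
qed

text \<open>For a fixed grid size this is a supremum over finitely many measurable sums; the index
  set varies only with the grid size, which is split into its countably many values.\<close>

lemma measurable_swap_agn:
  assumes "finite A" "set_pmf D \<subseteq> A" "fst ` A \<subseteq> X" "finite H"
  shows "(\<lambda>w. swap_agn l H D (fst w) (snd w)) \<in> borel_measurable (predictor_space X)"
proof -
  have "(\<lambda>w. SUP \<phi>\<in>grid n \<rightarrow>\<^sub>E H. swap_excess l A D n (snd w) \<phi>)
    \<in> borel_measurable (predictor_space X)" for n
  proof (rule borel_measurable_cSUP)
    have fin: "finite (grid n \<rightarrow>\<^sub>E H)"
      using assms(4) by (intro finite_PiE) auto
    then show "countable (grid n \<rightarrow>\<^sub>E H)"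
      "bdd_above ((\<lambda>\<phi>. swap_excess l A D n (snd w) \<phi>) ` (grid n \<rightarrow>\<^sub>E H))" for w
      by (auto intro: countable_finite)
    show "(\<lambda>w. swap_excess l A D n (snd w) \<phi>) \<in> borel_measurable (predictor_space X)" for \<phi>
      unfolding swap_excess_def using assms(3)
      by (intro borel_measurable_sum borel_measurable_times borel_measurable_const
          measurable_pmf_predictor) auto
  qed
  from measurable_compose_countable[OF this measurable_grid_size]
  have "(\<lambda>w. SUP \<phi>\<in>grid (fst w) \<rightarrow>\<^sub>E H. swap_excess l A D (fst w) (snd w) \<phi>)
    \<in> borel_measurable (predictor_space X)" .
  then show ?thesis
    by (rule measurable_cong[THEN iffD2, rotated]) (use swap_agn_eq[OF assms(1-3)] in auto)
qed

text \<open>Each objective is a convex combination of loss differences, so their bound passes to it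
  and to the supremum. This supplies integrability under the learner's kernel.\<close>

lemma abs_swap_agn_le:
  assumes "finite A" "set_pmf D \<subseteq> A" "fst ` A \<subseteq> X" "(N, q) \<in> predictors X" "H \<noteq> {}"
    and l: "\<And>x y u v. (x, y) \<in> A \<Longrightarrow> \<bar>l u y - l v y\<bar> \<le> B"
  shows "\<bar>swap_agn l H D N q\<bar> \<le> B"
proof -
  have inner: "\<bar>\<Sum>v\<in>grid N. pmf (q (fst z)) v * (l v (snd z) - l (\<phi> v (fst z)) (snd z))\<bar> \<le> B"
    if "z \<in> A" for z \<phi>
  proof -
    have "\<bar>\<Sum>v\<in>grid N. pmf (q (fst z)) v * (l v (snd z) - l (\<phi> v (fst z)) (snd z))\<bar>
      \<le> (\<Sum>v\<in>grid N. pmf (q (fst z)) v * B)"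
      using that l[of "fst z" "snd z"]
      by (intro order_trans[OF sum_abs] sum_mono) (auto simp: abs_mult intro!: mult_left_mono)
    also have "\<dots> = B"
      using assms(3,4) that unfolding sum_distrib_right[symmetric]
      by (subst sum_pmf_eq_1) (auto simp: predictors_def PiE_iff)
    finally show ?thesis .
  qed
  have "\<bar>swap_excess l A D N q \<phi>\<bar> \<le> B" for \<phi>
  proof -
    have "\<bar>swap_excess l A D N q \<phi>\<bar> \<le> (\<Sum>z\<in>A. pmf D z * B)"
      unfolding swap_excess_def using inner
      by (intro order_trans[OF sum_abs] sum_mono) (auto simp: abs_mult intro!: mult_left_mono)
    also have "\<dots> = B"
      unfolding sum_distrib_right[symmetric] using assms(1,2) by (subst sum_pmf_eq_1) auto
    finally show ?thesis .
  qed
  then show ?thesis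
    unfolding swap_agn_eq[OF assms(1-4)] using assms(5)
    by (intro cSup_abs_le) (auto simp: PiE_eq_empty_iff)
qed

section \<open>The hard family: point masses, excess risk, affinity\<close>

definition hard_dist :: "nat \<Rightarrow> real \<Rightarrow> nat set \<Rightarrow> (nat \<times> real) pmf" where
  "hard_dist d e \<sigma> = do {
     i \<leftarrow> pmf_of_set {..<d};
     map_pmf (\<lambda>b. (i, of_bool b)) (bernoulli_pmf (1/2 + (if i \<in> \<sigma> then e else - e)))}"

lemma pmf_hard_dist:
  assumes "i < d" "\<bar>e\<bar> \<le> 1/2" "y \<in> {0, 1}"
  shows "pmf (hard_dist d e \<sigma>) (i, y)
    = (1/2 + (if i \<in> \<sigma> \<longleftrightarrow> y = 1 then e else - e)) / real d"
proof -
  obtain b where b: "y = of_bool b"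
    using assms(3) that[of True] that[of False] by auto
  have "pmf (map_pmf (\<lambda>b. (j, of_bool b :: real)) M) (i, y) = (if j = i then pmf M b else 0)"
    for j and M :: "bool pmf"
  proof (cases "j = i")
    case True
    have "inj (\<lambda>b. (i, of_bool b :: real))" by (auto simp: inj_def)
    from pmf_map_inj'[OF this, of M b] True b show ?thesis by simp
  next
    case False
    then show ?thesis by (auto simp: pmf_eq_0_set_pmf)
  qed
  moreover have "{..<d} \<inter> {xa. xa = i} = {i}" using assms(1) by auto
  ultimately have "pmf (hard_dist d e \<sigma>) (i, y)
    = pmf (bernoulli_pmf (1/2 + (if i \<in> \<sigma> then e else - e))) b / real d"
    unfolding hard_dist_def using assms by (subst pmf_bind_pmf_of_set) (auto simp: sum.If_cases)
  \<comment> \<open>\<open>bernoulli_pmf\<close> clamps its parameter to [0, 1]; the bound on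
    \<open>e\<close> rules clamping out.\<close>
  then show ?thesis using assms(2) b by (cases b) (auto simp: abs_le_iff)
qed

lemma set_hard_dist:
  assumes "0 < d"
  shows "set_pmf (hard_dist d e \<sigma>) \<subseteq> {..<d} \<times> {0, 1}"
proof -
  have "set_pmf (pmf_of_set {..<d}) = {..<d}"
    using assms by (intro set_pmf_of_set) auto
  then have "set_pmf (hard_dist d e \<sigma>)
    = (\<Union>i<d. (\<lambda>b. (i, of_bool b))
        ` set_pmf (bernoulli_pmf (1/2 + (if i \<in> \<sigma> then e else - e))))"
    unfolding hard_dist_def set_bind_pmf set_map_pmf by simp
  also have "\<dots> \<subseteq> (\<Union>i<d. {(i, 0), (i, 1)})"
    by (intro UN_mono image_subsetI) (simp_all add: of_bool_def)
  also have "\<dots> = {..<d} \<times> {0, 1}" by blast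
  finally show ?thesis .
qed

lemma sum_labels:
  fixes f :: "'a \<times> real \<Rightarrow> real"
  shows "(\<Sum>z\<in>X \<times> {0, 1}. f z) = (\<Sum>i\<in>X. f (i, 0) + f (i, 1))"
proof -
  have "(\<Sum>z\<in>X \<times> {0, 1}. f z) = (\<Sum>i\<in>X. \<Sum>y\<in>{0, 1}. f (i, y))"
    by (simp only: sum.cartesian_product) (simp add: case_prod_eta)
  then show ?thesis by simp
qed

text \<open>\<open>loss_or\<close> depends on the prediction only through its side of 1/2. At
  covariate \<open>i\<close>, which has mass \<open>1 / d\<close>, the conditional mean loss is
  \<open>- e\<close> on the side of \<open>h i\<close> and \<open>e\<close> on the other, so exactly
  the predictions on the other side cost an extra \<open>2 * e\<close>.\<close>

lemma swap_excess_hard_dist: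
  assumes "\<bar>e\<bar> \<le> 1/2" "(N, q) \<in> predictors {..<d}" "\<And>i. i < d \<Longrightarrow> h i = of_bool (i \<in> \<sigma>)"
  shows "swap_excess loss_or ({..<d} \<times> {0, 1}) (hard_dist d e \<sigma>) N q (\<lambda>_. h)
    = 2 * e / real d * (\<Sum>i<d. if i \<in> \<sigma> then measure_pmf.prob (q i) {..1/2}
        else 1 - measure_pmf.prob (q i) {..1/2})"
proof -
  let ?D = "hard_dist d e \<sigma>"
  have "swap_excess loss_or ({..<d} \<times> {0, 1}) ?D N q (\<lambda>_. h)
    = (\<Sum>i<d. \<Sum>v\<in>grid N. pmf (q i) v *
          (pmf ?D (i, 0) * (loss_or v 0 - loss_or (h i) 0)
           + pmf ?D (i, 1) * (loss_or v 1 - loss_or (h i) 1)))"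
    unfolding swap_excess_def sum_labels
    by (simp add: sum_distrib_left sum.distrib[symmetric] algebra_simps)
  also have "\<dots> = (\<Sum>i<d. 2 * e / real d * (if i \<in> \<sigma> then measure_pmf.prob (q i) {..1/2}
        else 1 - measure_pmf.prob (q i) {..1/2}))"
  proof (intro sum.cong refl)
    fix i assume i: "i \<in> {..<d}"
    \<comment> \<open>The side opposite to \<open>h i\<close>; the value 1/2 itself counts as low,
      as in \<open>loss_or\<close>.\<close>
    let ?B = "if i \<in> \<sigma> then {..1/2} else {1/2<..} :: real set"
    have "pmf (q i) v *
          (pmf ?D (i, 0) * (loss_or v 0 - loss_or (h i) 0)
           + pmf ?D (i, 1) * (loss_or v 1 - loss_or (h i) 1))
        = 2 * e / real d * (if v \<in> ?B then pmf (q i) v else 0)" for v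
      using i assms(1) by (auto simp: pmf_hard_dist assms(3) loss_or_def field_simps)
    then have "(\<Sum>v\<in>grid N. pmf (q i) v *
          (pmf ?D (i, 0) * (loss_or v 0 - loss_or (h i) 0)
           + pmf ?D (i, 1) * (loss_or v 1 - loss_or (h i) 1)))
      = 2 * e / real d * (\<Sum>v\<in>grid N \<inter> ?B. pmf (q i) v)"
      by (simp only: sum_distrib_left[symmetric] sum.inter_restrict finite_grid)
    also have "\<dots> = 2 * e / real d * measure_pmf.prob (q i) ?B"
      using i by (simp add: prob_predictor_eq_sum[OF assms(2)])
    also have "measure_pmf.prob (q i) ?B = (if i \<in> \<sigma> then measure_pmf.prob (q i) {..1/2}
        else 1 - measure_pmf.prob (q i) {..1/2})"
      using measure_pmf.prob_compl[of "{..1/2}" "q i"] by (simp add: Compl_eq_Diff_UNIV[symmetric])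
    finally show "(\<Sum>v\<in>grid N. pmf (q i) v *
          (pmf ?D (i, 0) * (loss_or v 0 - loss_or (h i) 0)
           + pmf ?D (i, 1) * (loss_or v 1 - loss_or (h i) 1)))
      = 2 * e / real d * (if i \<in> \<sigma> then measure_pmf.prob (q i) {..1/2}
        else 1 - measure_pmf.prob (q i) {..1/2})" .
  qed
  finally show ?thesis by (simp add: sum_distrib_left)
qed

text \<open>The two laws differ only at covariate \<open>i\<close>. Every other covariate
  contributes \<open>1 / d\<close>; \<open>i\<close> contributes
  \<open>sqrt (1 - 4 * e\<^sup>2) / d\<close>, and \<open>sqrt t \<ge> t\<close> on [0, 1].\<close>

lemma affinity_hard_dist:
  assumes "0 \<le> e" "e \<le> 1/2" "i < d"
  shows "(\<Sum>z\<in>{..<d} \<times> {0, 1}. sqrt (pmf (hard_dist d e (insert i \<sigma>)) z * pmf (hard_dist d e (\<sigma> - {i})) z))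
    \<ge> 1 - 4 * e\<^sup>2 / real d"
proof -
  let ?P = "hard_dist d e (insert i \<sigma>)" and ?Q = "hard_dist d e (\<sigma> - {i})"
  let ?g = "\<lambda>j y. sqrt (pmf ?P (j, y) * pmf ?Q (j, y))"
  have e2: "4 * e\<^sup>2 \<le> 1"
    using power_mono[OF assms(2,1), of 2] by (simp add: power2_eq_square)
  have off: "?g j 0 + ?g j 1 = 1 / real d" if "j < d" "j \<noteq> i" for j
  proof -
    have "?g j y = (1/2 + (if j \<in> \<sigma> \<longleftrightarrow> y = 1 then e else - e)) / real d" if "y \<in> {0, 1}" for y
      using that \<open>j < d\<close> \<open>j \<noteq> i\<close> assms by (auto simp: pmf_hard_dist real_sqrt_mult[symmetric] simp flip: power2_eq_square)
    from this[of 0] this[of 1] show ?thesis by (auto simp: add_divide_distrib[symmetric])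
  qed
  have on: "?g i 0 + ?g i 1 \<ge> (1 - 4 * e\<^sup>2) / real d"
  proof -
    have "(1 - 4 * e\<^sup>2) / 2 / real d \<le> ?g i y" if "y \<in> {0, 1}" for y
    proof (rule real_le_rsqrt)
      have "(1 - 4 * e\<^sup>2)\<^sup>2 \<le> 1 - 4 * e\<^sup>2"
        using e2 mult_left_mono[of "1 - 4 * e\<^sup>2" 1 "1 - 4 * e\<^sup>2"] by (simp add: power2_eq_square)
      then have "((1 - 4 * e\<^sup>2) / 2 / real d)\<^sup>2 \<le> (1 - 4 * e\<^sup>2) / (4 * (real d)\<^sup>2)"
        by (simp add: power_divide divide_right_mono)
      also have "\<dots> = pmf ?P (i, y) * pmf ?Q (i, y)"
        using that assms by (auto simp: pmf_hard_dist power2_eq_square field_simps)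
      finally show "((1 - 4 * e\<^sup>2) / 2 / real d)\<^sup>2 \<le> pmf ?P (i, y) * pmf ?Q (i, y)" .
    qed
    from this[of 0] this[of 1] show ?thesis by (simp add: field_simps)
  qed
  have "1 - 4 * e\<^sup>2 / real d = (\<Sum>j\<in>{..<d} - {i}. 1 / real d) + (1 - 4 * e\<^sup>2) / real d"
    using assms(3) by (simp add: field_simps of_nat_diff)
  also have "\<dots> \<le> (\<Sum>j\<in>{..<d} - {i}. ?g j 0 + ?g j 1) + (?g i 0 + ?g i 1)"
    using off on by (intro add_mono sum_mono) auto
  also have "\<dots> = (\<Sum>j<d. ?g j 0 + ?g j 1)"
    using assms(3) by (subst sum.remove[of "{..<d}" i]) auto
  finally show ?thesis by (simp add: sum_labels)
qed

section \<open>Averaging the risk of a learner over the family\<close>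

text \<open>Toggling membership of \<open>i\<close> is an involution of \<open>Pow X\<close>, and
  \<open>insert i \<sigma>\<close> and \<open>\<sigma> - {i}\<close> are \<open>\<sigma>\<close> and
  its toggle in some order.\<close>

lemma sum_Pow_flip:
  fixes f :: "'a set \<Rightarrow> real"
  assumes "finite X" "i \<in> X"
  shows "2 * (\<Sum>\<sigma>\<in>Pow X. f \<sigma>) = (\<Sum>\<sigma>\<in>Pow X. f (insert i \<sigma>) + f (\<sigma> - {i}))"
proof -
  have "(\<Sum>\<sigma>\<in>Pow X. f \<sigma>) = (\<Sum>\<sigma>\<in>Pow X. if i \<in> \<sigma> then f (\<sigma> - {i}) else f (insert i \<sigma>))"
    using assms(2)
    by (intro sum.reindex_bij_witness[where i = "\<lambda>\<sigma>. if i \<in> \<sigma> then \<sigma> - {i} else insert i \<sigma>"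
          and j = "\<lambda>\<sigma>. if i \<in> \<sigma> then \<sigma> - {i} else insert i \<sigma>"])
      (auto simp: insert_absorb)
  then have "2 * (\<Sum>\<sigma>\<in>Pow X. f \<sigma>)
    = (\<Sum>\<sigma>\<in>Pow X. f \<sigma> + (if i \<in> \<sigma> then f (\<sigma> - {i}) else f (insert i \<sigma>)))"
    by (simp add: sum.distrib)
  also have "\<dots> = (\<Sum>\<sigma>\<in>Pow X. f (insert i \<sigma>) + f (\<sigma> - {i}))"
    by (intro sum.cong) (auto simp: insert_absorb)
  finally show ?thesis .
qed

lemma learner_prob_space:
  assumes "randomized_learner X m L" "length s = m" "set s \<subseteq> X \<times> {0, 1}"
  shows "prob_space (L s)" "sets (L s) = sets (predictor_space X)" "space (L s) = predictors X"
proof -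
  have "L s \<in> space (prob_algebra (predictor_space X))"
    using assms unfolding randomized_learner_def by (auto dest: measurable_space)
  then show "prob_space (L s)" and *: "sets (L s) = sets (predictor_space X)"
    by (auto simp: space_prob_algebra)
  from sets_eq_imp_space_eq[OF *] show "space (L s) = predictors X" by simp
qed

text \<open>\<open>W s i\<close> is the chance, given the sample, of predicting at most 1/2 at
  \<open>i\<close>. The swap risk of every output dominates its excess over the indicator of
  \<open>\<sigma>\<close>; this is integrated over the kernel, then over the sample.\<close>

lemma expected_swap_agn_hard_dist:
  fixes L d
  defines "W \<equiv> \<lambda>s i. \<integral>w. measure_pmf.prob (snd w i) {..1/2} \<partial>L s"
  assumes L: "randomized_learner {..<d} m L" and d: "0 < d" and e: "0 \<le> e" "e \<le> 1/2"
  shows "expected_swap_agn loss_or ({..<d} \<rightarrow>\<^sub>E {0, 1}) m L (hard_dist d e \<sigma>)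
    \<ge> 2 * e / real d * (\<Sum>i<d. measure_pmf.expectation (replicate_pmf m (hard_dist d e \<sigma>))
          (\<lambda>s. if i \<in> \<sigma> then W s i else 1 - W s i))"
proof -
  let ?X = "{..<d}" and ?A = "{..<d} \<times> {0, 1::real}" and ?D = "hard_dist d e \<sigma>"
  let ?H = "?X \<rightarrow>\<^sub>E {0, 1::real}"
  let ?p = "\<lambda>w i. measure_pmf.prob (snd w i) {..1/2} :: real"
  have D: "set_pmf ?D \<subseteq> ?A" using d by (rule set_hard_dist)
  have finA: "finite ?A" by simp
  have A: "fst ` ?A \<subseteq> ?X" by auto
  have H: "finite ?H" by (intro finite_PiE) auto
  define h where "h = restrict (\<lambda>i. of_bool (i \<in> \<sigma>) :: real) ?X"
  have h: "h \<in> ?H" by (auto simp: h_def)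
  then have ne: "?H \<noteq> {}" by blast
  have e_abs: "\<bar>e\<bar> \<le> 1/2" using e by simp
  have h_eq: "h i = of_bool (i \<in> \<sigma>)" if "i < d" for i
    using that by (simp add: h_def)
  have main: "(\<integral>w. swap_agn loss_or ?H ?D (fst w) (snd w) \<partial>L s)
      \<ge> 2 * e / real d * (\<Sum>i<d. if i \<in> \<sigma> then W s i else 1 - W s i)"
    if s: "length s = m" "set s \<subseteq> ?A" for s
  proof -
    note Ls = learner_prob_space[OF L s]
    interpret prob_space "L s" by (rule Ls(1))
    have [measurable]: "(\<lambda>w. ?p w i) \<in> borel_measurable (L s)" if "i < d" for i
      using measurable_prob_predictor[of i ?X] that by (simp add: measurable_cong_sets[OF Ls(2) refl])
    have int: "integrable (L s) (\<lambda>w. ?p w i)" if "i < d" for i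
      using that by (intro integrable_const_bound[where B = 1]) auto
    have int_W: "integrable (L s) (\<lambda>w. if i \<in> \<sigma> then ?p w i else 1 - ?p w i)" if "i < d" for i
      using int[OF that] by (cases "i \<in> \<sigma>") simp_all
    \<comment> \<open>A non-integrable function would have integral 0 by convention, so monotonicity
      needs this. The bound is 1 because \<open>loss_or\<close> is -1/2 or 1/2 on binary
      labels.\<close>
    have int_swap: "integrable (L s) (\<lambda>w. swap_agn loss_or ?H ?D (fst w) (snd w))"
    proof (rule integrable_const_bound[where B = 1])
      show "(\<lambda>w. swap_agn loss_or ?H ?D (fst w) (snd w)) \<in> borel_measurable (L s)"
        using measurable_swap_agn[OF finA D A H] by (simp add: measurable_cong_sets[OF Ls(2) refl])
      have "\<bar>swap_agn loss_or ?H ?D (fst w) (snd w)\<bar> \<le> 1" if "w \<in> predictors ?X" for w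
      proof (rule abs_swap_agn_le[OF finA D A _ ne])
        show "(fst w, snd w) \<in> predictors ?X" using that by simp
        show "\<bar>loss_or u y - loss_or v y\<bar> \<le> 1" if "(x, y) \<in> ?A" for x y u v
        proof -
          have "y = 0 \<or> y = 1" using that by auto
          then show ?thesis unfolding loss_or_def by (auto split: if_split)
        qed
      qed
      then show "AE w in L s. norm (swap_agn loss_or ?H ?D (fst w) (snd w)) \<le> 1"
        by (intro AE_I2) (simp add: Ls(3))
    qed
    have "2 * e / real d * (\<Sum>i<d. if i \<in> \<sigma> then W s i else 1 - W s i)
      = 2 * e / real d * (\<Sum>i<d. \<integral>w. (if i \<in> \<sigma> then ?p w i else 1 - ?p w i) \<partial>L s)"
    proof -
      have "(if i \<in> \<sigma> then W s i else 1 - W s i)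
        = (\<integral>w. (if i \<in> \<sigma> then ?p w i else 1 - ?p w i) \<partial>L s)" if "i < d" for i
      proof (cases "i \<in> \<sigma>")
        case False
        then show ?thesis
          using Bochner_Integration.integral_diff[OF _ int[OF that], of "\<lambda>_. 1"]
          by (simp add: W_def prob_space)
      qed (simp add: W_def)
      then show ?thesis by simp
    qed
    also have "\<dots> = (\<integral>w. 2 * e / real d * (\<Sum>i<d. if i \<in> \<sigma> then ?p w i else 1 - ?p w i) \<partial>L s)"
    proof -
      have "(\<Sum>i<d. \<integral>w. (if i \<in> \<sigma> then ?p w i else 1 - ?p w i) \<partial>L s)
        = (\<integral>w. (\<Sum>i<d. if i \<in> \<sigma> then ?p w i else 1 - ?p w i) \<partial>L s)"
        by (intro Bochner_Integration.integral_sum[symmetric] int_W) simp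
      then show ?thesis by simp
    qed
    also have "\<dots> \<le> (\<integral>w. swap_agn loss_or ?H ?D (fst w) (snd w) \<partial>L s)"
    proof (rule integral_mono)
      show "integrable (L s) (\<lambda>w. 2 * e / real d * (\<Sum>i<d. if i \<in> \<sigma> then ?p w i else 1 - ?p w i))"
        by (intro integrable_mult_right Bochner_Integration.integrable_sum int_W) simp
      fix w assume "w \<in> space (L s)"
      then have w: "(fst w, snd w) \<in> predictors ?X" by (simp add: Ls(3))
      show "2 * e / real d * (\<Sum>i<d. if i \<in> \<sigma> then ?p w i else 1 - ?p w i)
        \<le> swap_agn loss_or ?H ?D (fst w) (snd w)"
        using swap_agn_ge[OF finA D A w H h, of loss_or]
          swap_excess_hard_dist[OF e_abs w h_eq] by simp
    qed (rule int_swap)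
    finally show ?thesis .
  qed
  \<comment> \<open>Samples lie in a finite set, so sums over samples and coordinates can be
    exchanged.\<close>
  let ?S = "{s. set s \<subseteq> ?A \<and> length s = m}" and ?P = "pmf (replicate_pmf m ?D)"
  have "2 * e / real d * (\<Sum>i<d. measure_pmf.expectation (replicate_pmf m ?D)
          (\<lambda>s. if i \<in> \<sigma> then W s i else 1 - W s i))
    = 2 * e / real d * (\<Sum>i<d. \<Sum>s\<in>?S. ?P s * (if i \<in> \<sigma> then W s i else 1 - W s i))"
    by (simp only: expectation_replicate_pmf[OF finA D])
  also have "\<dots> = (\<Sum>s\<in>?S. ?P s * (2 * e / real d * (\<Sum>i<d. if i \<in> \<sigma> then W s i else 1 - W s i)))"
    by (subst sum.swap) (simp add: sum_distrib_left mult_ac)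
  also have "\<dots> \<le> (\<Sum>s\<in>?S. ?P s * (\<integral>w. swap_agn loss_or ?H ?D (fst w) (snd w) \<partial>L s))"
    using main by (intro sum_mono mult_left_mono) auto
  finally show ?thesis
    unfolding expected_swap_agn_def expectation_replicate_pmf[OF finA D] by (simp add: case_prod_beta')
qed

text \<open>Each coordinate errs with average probability at least 1/6, and \<open>2 * e\<close>
  times 1/6 is \<open>sqrt (d / m) / 12\<close>.\<close>

lemma average_expected_swap_agn:
  assumes L: "randomized_learner {..<d} m L" and d: "1 \<le> d" "d \<le> m"
    and e: "e = sqrt (real d / real m) / 4"
  shows "(\<Sum>\<sigma>\<in>Pow {..<d}. expected_swap_agn loss_or ({..<d} \<rightarrow>\<^sub>E {0, 1}) m L (hard_dist d e \<sigma>))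
    \<ge> real (card (Pow {..<d})) * (1/12 * sqrt (real d / real m))"
proof -
  let ?A = "{..<d} \<times> {0, 1::real}"
  define W where "W s i = (\<integral>w. measure_pmf.prob (snd w i) {..1/2} \<partial>L s)" for s i
  let ?E = "\<lambda>\<sigma>. measure_pmf.expectation (replicate_pmf m (hard_dist d e \<sigma>))"
  let ?f = "\<lambda>\<sigma> i. ?E \<sigma> (\<lambda>s. if i \<in> \<sigma> then W s i else 1 - W s i)"
  \<comment> \<open>Here \<open>d \<le> m\<close> enters: it keeps \<open>e\<close> at most 1/4, so
    the label means are valid.\<close>
  have "sqrt (real d / real m) \<le> 1" using d by simp
  then have e0: "0 \<le> e" and e1: "e \<le> 1/2" unfolding e by (linarith | simp)+
  \<comment> \<open>The scale of \<open>e\<close> is chosen so that one example costs affinity at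
    most \<open>1 / (4 * m)\<close>.\<close>
  have e2: "4 * e\<^sup>2 / real d = 1 / (4 * real m)"
    using d by (simp add: e power_divide field_simps)
  have W: "0 \<le> W s i" "W s i \<le> 1" if "set s \<subseteq> ?A" "length s = m" "i < d" for s i
  proof -
    note Ls = learner_prob_space[OF L that(2,1)]
    interpret prob_space "L s" by (rule Ls(1))
    show "0 \<le> W s i" unfolding W_def by (intro integral_nonneg_AE) auto
    have "integrable (L s) (\<lambda>w. measure_pmf.prob (snd w i) {..1/2})"
      using measurable_prob_predictor[of i "{..<d}"] that
      by (intro integrable_const_bound[where B = 1]) (auto simp: measurable_cong_sets[OF Ls(2) refl])
    then show "W s i \<le> 1" unfolding W_def by (intro integral_le_const) auto
  qed
  have two: "1/3 \<le> ?f (insert i \<sigma>) i + ?f (\<sigma> - {i}) i" if i: "i < d" for i \<sigma>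
  proof -
    let ?a = "\<Sum>z\<in>?A. sqrt (pmf (hard_dist d e (insert i \<sigma>)) z * pmf (hard_dist d e (\<sigma> - {i})) z)"
    have m1: "1 / (4 * real m) \<le> 1" using d by (simp add: field_simps)
    \<comment> \<open>By Bernoulli's inequality \<open>m\<close> examples cost at most 1/4 in total.
      An affinity of 3/4 exceeds 1/2, where the testing bound becomes trivial, and gives
      \<open>(4 * 3/4 - 2) / 3 = 1/3\<close>.\<close>
    have "3/4 = 1 + real m * (- (1 / (4 * real m)))" using d by simp
    also have "\<dots> \<le> (1 + - (1 / (4 * real m))) ^ m"
      using m1 by (intro Bernoulli_inequality) auto
    also have "\<dots> \<le> ?a ^ m"
      using affinity_hard_dist[OF e0 e1 i, of \<sigma>] m1 unfolding e2 by (intro power_mono) auto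
    finally have "1/3 \<le> (4 * ?a ^ m - 2) / 3" by simp
    also have "\<dots> \<le> ?E (insert i \<sigma>) (\<lambda>s. W s i) + ?E (\<sigma> - {i}) (\<lambda>s. 1 - W s i)"
      using d W i by (intro two_point_testing_bound set_hard_dist) auto
    finally show ?thesis by simp
  qed
  \<comment> \<open>The pairing counts every \<open>\<sigma>\<close> twice, so 1/3 per pair becomes
    1/6 on average.\<close>
  have half: "(\<Sum>\<sigma>\<in>Pow {..<d}. ?f \<sigma> i) \<ge> real (card (Pow {..<d})) / 6" if "i < d" for i
  proof -
    have "real (card (Pow {..<d})) / 3 = (\<Sum>\<sigma>\<in>Pow {..<d}. 1/3)" by simp
    also have "\<dots> \<le> (\<Sum>\<sigma>\<in>Pow {..<d}. ?f (insert i \<sigma>) i + ?f (\<sigma> - {i}) i)"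
      by (intro sum_mono two that)
    also have "\<dots> = 2 * (\<Sum>\<sigma>\<in>Pow {..<d}. ?f \<sigma> i)"
      using that by (intro sum_Pow_flip[symmetric]) auto
    finally show ?thesis by simp
  qed
  have "real (card (Pow {..<d})) * (1/12 * sqrt (real d / real m))
    = 2 * e / real d * (\<Sum>i<d. real (card (Pow {..<d})) / 6)"
    using d by (simp add: e)
  also have "\<dots> \<le> 2 * e / real d * (\<Sum>i<d. \<Sum>\<sigma>\<in>Pow {..<d}. ?f \<sigma> i)"
    using half e0 by (intro mult_left_mono sum_mono) auto
  also have "\<dots> = (\<Sum>\<sigma>\<in>Pow {..<d}. 2 * e / real d * (\<Sum>i<d. ?f \<sigma> i))"
    by (subst sum.swap) (simp add: sum_distrib_left)
  also have "\<dots> \<le> (\<Sum>\<sigma>\<in>Pow {..<d}.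
      expected_swap_agn loss_or ({..<d} \<rightarrow>\<^sub>E {0, 1}) m L (hard_dist d e \<sigma>))"
    unfolding W_def using L d e0 e1 by (intro sum_mono expected_swap_agn_hard_dist) auto
  finally show ?thesis .
qed

theorem lemma5p12:
  shows "\<exists>c>0::real. \<exists>c'>0::real. \<forall>d m::nat. 1 \<le> d \<and> d \<le> m \<longrightarrow>
    (\<exists>(X::nat set) (H::(nat \<Rightarrow> real) set) (\<D>::(nat \<times> real) pmf set).
       H \<subseteq> X \<rightarrow>\<^sub>E {0..1} \<and> card H = 2 ^ d \<and>
       \<D> \<noteq> {} \<and> (\<forall>D\<in>\<D>. set_pmf D \<subseteq> X \<times> {0, 1}) \<and>
       (\<forall>L. randomized_learner X m L \<longrightarrow>
          (SUP D\<in>\<D>. expected_swap_agn loss_or H m L D) \<ge> c * sqrt (real d / real m)) \<and>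
       c * sqrt (real d / real m) \<ge> c' * sqrt (ln (real (card H)) / real m))"
proof (intro exI[of _ "1/12 :: real"] conjI allI impI)
  fix d m :: nat
  assume d: "1 \<le> d \<and> d \<le> m"
  define e where "e = sqrt (real d / real m) / 4"
  let ?X = "{..<d}"
  let ?H = "?X \<rightarrow>\<^sub>E {0, 1 :: real}"
  let ?\<D> = "hard_dist d e ` Pow ?X"
  have card: "card ?H = 2 ^ d" by (simp add: card_PiE numeral_2_eq_2)
  have "1/12 * sqrt (real d / real m) \<le> (SUP D\<in>?\<D>. expected_swap_agn loss_or ?H m L D)"
    if L: "randomized_learner ?X m L" for L
  proof -
    let ?s = "SUP D\<in>?\<D>. expected_swap_agn loss_or ?H m L D"
    have "real (card (Pow ?X)) * (1/12 * sqrt (real d / real m))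
      \<le> (\<Sum>\<sigma>\<in>Pow ?X. expected_swap_agn loss_or ?H m L (hard_dist d e \<sigma>))"
      using average_expected_swap_agn[OF L _ _ e_def] d by simp
    \<comment> \<open>The supremum over the finite family is at least the average; the factor
      \<open>2 ^ d\<close> then cancels.\<close>
    also have "\<dots> \<le> (\<Sum>\<sigma>\<in>Pow ?X. ?s)"
      by (intro sum_mono cSUP_upper) auto
    finally show ?thesis by (simp add: card_Pow)
  qed
  \<comment> \<open>Since \<open>ln 2 < 1\<close>, the logarithmic form holds with the same
    constant: both \<open>c\<close> and \<open>c'\<close> are 1/12.\<close>
  moreover have "ln (real (card ?H)) \<le> real d"
    using ln_2_less_1 by (simp add: card ln_realpow mult_left_le)
  then have "1/12 * sqrt (ln (real (card ?H)) / real m) \<le> 1/12 * sqrt (real d / real m)"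
    by (intro mult_left_mono real_sqrt_le_mono divide_right_mono) auto
  moreover have "?H \<subseteq> ?X \<rightarrow>\<^sub>E {0..1}" by (intro PiE_mono) auto
  moreover have "\<forall>D\<in>?\<D>. set_pmf D \<subseteq> ?X \<times> {0, 1}" using d set_hard_dist by auto
  ultimately show "\<exists>(X::nat set) (H::(nat \<Rightarrow> real) set) (\<D>::(nat \<times> real) pmf set).
       H \<subseteq> X \<rightarrow>\<^sub>E {0..1} \<and> card H = 2 ^ d \<and>
       \<D> \<noteq> {} \<and> (\<forall>D\<in>\<D>. set_pmf D \<subseteq> X \<times> {0, 1}) \<and>
       (\<forall>L. randomized_learner X m L \<longrightarrow>
          (SUP D\<in>\<D>. expected_swap_agn loss_or H m L D) \<ge> 1/12 * sqrt (real d / real m)) \<and>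
       1/12 * sqrt (real d / real m) \<ge> 1/12 * sqrt (ln (real (card H)) / real m)"
    using card by (intro exI[of _ ?X] exI[of _ ?H] exI[of _ ?\<D>]) auto
qed auto

end
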